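(* For every finite set $A \subset \mathbb{Z}^2$, Picker has a winning strategy in the Chooser-Picker $7$-in-a-row game played on $A$.
   Context: A Chooser-Picker game on a finite hypergraph $(V,\mathcal{F})$, where $\mathcal{F}\subseteq 2^V$, is played as follows. In each round Picker selects two not yet taken vertices of $V$; Chooser takes one of them and the other goes to Picker. If $|V|$ is odd, the single vertex remaining at the end goes to Chooser. Chooser wins if at the end he owns all vertices of some edge $E\in\mathcal{F}$; otherwise Picker wins. Both players have perfect information. The $7$-in-a-row game on $A\subseteq\mathbb{Z}^2$ is the game on the hypergraph with vertex set $A$ whose edges are exactly those sets of the form $\{p, p+d, p+2d, \dots, p+6d\}$ with $p\in\mathbb{Z}^2$ and $d\in\{(1,0),(0,1),(1,1),(1,-1)\}$ (seven consecutive cells in a horizontal, vertical or diagonal line) that are entirely contained in $A$. *)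

theory Defs
  imports Main
begin

text \<open>Chooser-Picker game on a hypergraph with edge family F.
  A position is given by the set of still free vertices and the set C of
  vertices already owned by Chooser (Picker's vertices do not affect the outcome).
  cp_picker_wins F free C holds iff Picker has a winning strategy from this
  position, with Picker to move.  Since the game is finite, this is the usual
  backward-induction (inductive) characterisation of a winning strategy.\<close>

inductive cp_picker_wins :: "'a set set \<Rightarrow> 'a set \<Rightarrow> 'a set \<Rightarrow> bool"
  for F :: "'a set set" where
  finish_empty:
    "free = {} \<Longrightarrow> \<not> (\<exists>E\<in>F. E \<subseteq> C) \<Longrightarrow> cp_picker_wins F free C"
| finish_single:
    "free = {v} \<Longrightarrow> \<not> (\<exists>E\<in>F. E \<subseteq> insert v C) \<Longrightarrow> cp_picker_wins F free C"
| pick: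
    "x \<in> free \<Longrightarrow> y \<in> free \<Longrightarrow> x \<noteq> y
     \<Longrightarrow> cp_picker_wins F (free - {x, y}) (insert x C)
     \<Longrightarrow> cp_picker_wins F (free - {x, y}) (insert y C)
     \<Longrightarrow> cp_picker_wins F free C"

definition picker_wins_CP :: "'a set \<Rightarrow> 'a set set \<Rightarrow> bool" where
  "picker_wins_CP V F \<longleftrightarrow> cp_picker_wins F V {}"

definition seven_in_a_row_edges :: "(int \<times> int) set \<Rightarrow> (int \<times> int) set set" where
  "seven_in_a_row_edges A =
     {E. E \<subseteq> A \<and>
         (\<exists>p d. d \<in> {(1,0), (0,1), (1,1), (1,-1)} \<and>
                E = {(fst p + k * fst d, snd p + k * snd d) | k. k \<in> {0..6::int}})}"

end

theory Submission
  imports Defs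
begin

text \<open>
  Cut the plane into 8 by 4 rectangles.  Seven consecutive cells in a row contain an aligned
  block of four, and seven cells in any other direction cross some horizontal strip of height 4
  completely.  Hence every winning line contains one of a few sets of size at most four that lie in
  a single rectangle: half a row, a column, a whole diagonal, or a suitable piece of a diagonal
  that crosses the border between two rectangles.  Picker plays the rectangles independently,
  and an explicit strategy, found by computer search, prevents Chooser from completing any of
  these sets inside one rectangle.
\<close>

section \<open>Monotonicity of the Chooser-Picker game\<close>

text \<open>Picker repeats the same offers: an edge of \<open>G\<close> completed inside the smaller
  set \<open>D\<close> would contain an edge of \<open>F\<close> completed inside
  \<open>C\<close>.\<close>

lemma cp_picker_wins_mono:
  assumes "cp_picker_wins F U C" "\<And>E. E \<in> G \<Longrightarrow> \<exists>E'\<in>F. E' \<subseteq> E" "D \<subseteq> C"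
  shows "cp_picker_wins G U D"
  using assms(1,3)
proof (induction arbitrary: D)
  case (finish_empty U C)
  then have "\<not> (\<exists>E\<in>G. E \<subseteq> D)" using assms(2) by (meson subset_trans)
  with finish_empty show ?case by (simp add: cp_picker_wins.finish_empty)
next
  case (finish_single U v C)
  then have "\<not> (\<exists>E\<in>G. E \<subseteq> insert v D)" using assms(2) by (meson insert_mono subset_trans)
  with finish_single show ?case by (simp add: cp_picker_wins.finish_single)
next
  case (pick x U y C)
  show ?case
    by (rule cp_picker_wins.pick[OF pick.hyps(1-3)]; rule pick.IH; use pick.prems in blast)
qed

section \<open>Changing the set of free vertices\<close>

text \<open>Picker sets \<open>v\<close> aside and plays as if Chooser owned it. If \<open>U\<close>
  gets exhausted, \<open>v\<close> is the last vertex and falls to Chooser; if a single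
  \<open>w\<close> is left, Picker offers \<open>v\<close> against \<open>w\<close>, and Chooser
  gets only one of two vertices that he could have owned together.\<close>

lemma cp_picker_wins_free_chosen:
  assumes "cp_picker_wins F U (insert v C)" "v \<notin> U"
  shows "cp_picker_wins F (insert v U) C"
  using assms
proof (induction U "insert v C" arbitrary: C)
  case (finish_empty U)
  then show ?case by (intro cp_picker_wins.finish_single[of _ v]) auto
next
  case (finish_single U w)
  have "cp_picker_wins F {} (insert v C)" "cp_picker_wins F {} (insert w C)"
    using finish_single by (auto intro!: cp_picker_wins.finish_empty)
  moreover have "insert v U - {v, w} = {}" using finish_single by auto
  ultimately show ?case using finish_single
    by (simp add: cp_picker_wins.pick[of v _ w])
next
  case (pick x U y)
  have eq: "insert v U - {x, y} = insert v (U - {x, y})" using pick by auto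
  show ?case
  proof (rule cp_picker_wins.pick[of x _ y])
    show "cp_picker_wins F (insert v U - {x, y}) (insert x C)"
      unfolding eq using pick by (simp add: insert_commute)
    show "cp_picker_wins F (insert v U - {x, y}) (insert y C)"
      unfolding eq using pick by (simp add: insert_commute)
  qed (use pick in auto)
qed

text \<open>Picker follows the old strategy until it offers \<open>z\<close> with some partner. The
  partner then simply stays free, which by \<open>cp_picker_wins_free_chosen\<close> is no worse
  than the branch in which Chooser takes the partner and Picker receives \<open>z\<close>.\<close>

lemma cp_picker_wins_delete:
  assumes "cp_picker_wins F U C"
  shows "cp_picker_wins F (U - {z}) C"
  using assms
proof induction
  case (finish_empty U C)
  then show ?case by (intro cp_picker_wins.finish_empty) auto
next
  case (finish_single U v C)
  then show ?case
    by (cases "v = z") (auto intro: cp_picker_wins.finish_empty cp_picker_wins.finish_single)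
next
  case (pick x U y C)
  consider "z = x" | "z = y" | "z \<noteq> x" "z \<noteq> y" by auto
  then show ?case
  proof cases
    case 1
    have "U - {z} = insert y (U - {x, y})" using pick 1 by auto
    then show ?thesis using cp_picker_wins_free_chosen[OF pick.hyps(5)] by simp
  next
    case 2
    have "U - {z} = insert x (U - {x, y})" using pick 2 by auto
    then show ?thesis using cp_picker_wins_free_chosen[OF pick.hyps(4)] by simp
  next
    case 3
    have eq: "U - {z} - {x, y} = U - {x, y} - {z}" by auto
    show ?thesis
      by (rule cp_picker_wins.pick[of x _ y]) (use pick 3 in \<open>simp_all add: eq\<close>)
  qed
qed

lemma cp_picker_wins_subset:
  assumes "cp_picker_wins F U C" "finite U" "W \<subseteq> U"
  shows "cp_picker_wins F W C"
proof -
  have "cp_picker_wins F (U - X) C" if "finite X" for X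
    using that
  proof induction
    case (insert z X)
    have "U - insert z X = U - X - {z}" by auto
    then show ?case using cp_picker_wins_delete[OF insert.IH] by simp
  qed (simp add: assms)
  from this[of "U - W"] show ?thesis using assms by (simp add: double_diff)
qed

section \<open>Shrinking the edge family as vertices are taken\<close>

text \<open>Since \<open>E - C \<subseteq> D\<close> is equivalent to
  \<open>E \<subseteq> C \<union> D\<close>, vertices owned by Chooser can be erased from the
  edges.\<close>

lemma cp_picker_wins_residual:
  assumes "cp_picker_wins ((\<lambda>E. E - C) ` F) U D"
  shows "cp_picker_wins F U (C \<union> D)"
  using assms
proof induction
  case (finish_empty U D)
  then show ?case by (intro cp_picker_wins.finish_empty) (auto simp: Diff_subset_conv)
next
  case (finish_single U v D)
  then show ?case by (intro cp_picker_wins.finish_single[of _ v]) (auto simp: Diff_subset_conv)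
next
  case (pick x U y D)
  then show ?case by (simp add: cp_picker_wins.pick[of x _ y])
qed

text \<open>A vertex that is neither free nor Chooser's belongs to Picker, so the edges through it
  are dead.\<close>

lemma cp_picker_wins_avoid:
  assumes "cp_picker_wins {E \<in> F. y \<notin> E} U C" "y \<notin> U" "y \<notin> C"
  shows "cp_picker_wins F U C"
  using assms
proof induction
  case (finish_empty U C)
  then show ?case by (intro cp_picker_wins.finish_empty) auto
next
  case (finish_single U v C)
  then show ?case by (intro cp_picker_wins.finish_single[of _ v]) auto
next
  case (pick x U y' C)
  then have "y \<noteq> x" "y \<noteq> y'" by auto
  with pick show ?case by (simp add: cp_picker_wins.pick[of x _ y'])
qed

lemma cp_picker_wins_image:
  assumes "cp_picker_wins F U C" "inj f"
  shows "cp_picker_wins ((`) f ` F) (f ` U) (f ` C)"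
  using assms(1)
proof induction
  case (finish_empty U C)
  then show ?case
    by (intro cp_picker_wins.finish_empty) (auto simp: inj_image_subset_iff[OF assms(2)])
next
  case (finish_single U v C)
  have "insert (f v) (f ` C) = f ` insert v C" by simp
  then show ?case using finish_single
    by (intro cp_picker_wins.finish_single[of _ "f v"])
      (auto simp: inj_image_subset_iff[OF assms(2)] simp del: image_insert)
next
  case (pick x U y C)
  have eq: "f ` U - {f x, f y} = f ` (U - {x, y})" using assms(2) by (auto dest: injD)
  show ?case
    by (rule cp_picker_wins.pick[of "f x" _ "f y"])
      (use pick assms(2) in \<open>auto simp: eq dest: injD\<close>)
qed

section \<open>Sums of games on disjoint vertex sets\<close>

lemma safe_disjoint_Un:
  assumes "\<not> (\<exists>E\<in>F. E \<subseteq> C)" "\<not> (\<exists>E\<in>G. E \<subseteq> D)" "C \<inter> \<Union>G = {}" "D \<inter> \<Union>F = {}"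
  shows "\<not> (\<exists>E\<in>F \<union> G. E \<subseteq> C \<union> D)"
proof
  assume "\<exists>E\<in>F \<union> G. E \<subseteq> C \<union> D"
  then obtain E where E: "E \<in> F \<union> G" "E \<subseteq> C \<union> D" by blast
  then have "E \<in> F \<Longrightarrow> E \<subseteq> C" "E \<in> G \<Longrightarrow> E \<subseteq> D" using assms(3,4) by blast+
  then show False using E(1) assms(1,2) by blast
qed

text \<open>This is the stage of a sum at which the component \<open>F\<close> is exhausted and
  Chooser's set \<open>C\<close> there is already harmless.\<close>

lemma cp_picker_wins_add_safe:
  assumes "cp_picker_wins G W D" "\<not> (\<exists>E\<in>F. E \<subseteq> C)"
    "C \<inter> \<Union>G = {}" "(W \<union> D) \<inter> \<Union>F = {}"
  shows "cp_picker_wins (F \<union> G) W (C \<union> D)"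
  using assms
proof (induction)
  case (finish_empty W D)
  then have "\<not> (\<exists>E\<in>F \<union> G. E \<subseteq> C \<union> D)" by (intro safe_disjoint_Un) auto
  with finish_empty show ?case by (intro cp_picker_wins.finish_empty)
next
  case (finish_single W v D)
  then have "\<not> (\<exists>E\<in>F \<union> G. E \<subseteq> C \<union> insert v D)" by (intro safe_disjoint_Un) auto
  with finish_single show ?case by (intro cp_picker_wins.finish_single[of _ v]) auto
next
  case (pick x W y D)
  have "cp_picker_wins (F \<union> G) (W - {x, y}) (C \<union> insert x D)"
    "cp_picker_wins (F \<union> G) (W - {x, y}) (C \<union> insert y D)"
    by (rule pick.IH; use pick.hyps pick.prems in auto)+
  then show ?case using pick.hyps by (simp add: cp_picker_wins.pick[of x _ y])
qed

text \<open>Picker chooses both vertices of an offer, so the components can be played one after the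
  other without interference from Chooser.\<close>

lemma cp_picker_wins_disjoint_Un:
  assumes "cp_picker_wins F U C" "cp_picker_wins G W D" "U \<inter> W = {}"
    "(U \<union> C) \<inter> \<Union>G = {}" "(W \<union> D) \<inter> \<Union>F = {}"
  shows "cp_picker_wins (F \<union> G) (U \<union> W) (C \<union> D)"
  using assms
proof (induction)
  case (finish_empty U C)
  then show ?case using cp_picker_wins_add_safe[of G W D F C] by auto
next
  case (finish_single U v C)
  \<comment> \<open>An odd first component leaves \<open>v\<close> over while \<open>W\<close> may
    still be free. The win holds even with \<open>v\<close> given to Chooser, so \<open>v\<close>
    may remain free during the play on \<open>W\<close>.\<close>
  then have "cp_picker_wins (F \<union> G) W (insert v C \<union> D)"
    by (intro cp_picker_wins_add_safe) auto
  then show ?case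
    using cp_picker_wins_free_chosen[of "F \<union> G" W v "C \<union> D"] finish_single by auto
next
  case (pick x U y C)
  have eq: "(U \<union> W) - {x, y} = (U - {x, y}) \<union> W" using pick by auto
  have "cp_picker_wins (F \<union> G) ((U - {x, y}) \<union> W) (insert x C \<union> D)"
    "cp_picker_wins (F \<union> G) ((U - {x, y}) \<union> W) (insert y C \<union> D)"
    by (rule pick.IH; use pick in blast)+
  then show ?case
    using pick.hyps cp_picker_wins.pick[of x "U \<union> W" y, unfolded eq] by simp
qed

section \<open>Hypergraphs on which Picker wins\<close>

text \<open>Quantifying over all boards makes the predicate insensitive to vertices outside the edges.\<close>

definition picker_win :: "'a set set \<Rightarrow> bool" where
  "picker_win F \<longleftrightarrow> (\<forall>U. finite U \<longrightarrow> cp_picker_wins F U {})"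

text \<open>By \<open>cp_picker_wins_subset\<close> a win on a larger board suffices, so a board may
  first be enlarged by the vertices that Picker wants to offer.\<close>

lemma picker_winI:
  assumes "\<And>U. finite U \<Longrightarrow> \<exists>W. finite W \<and> U \<subseteq> W \<and> cp_picker_wins F W {}"
  shows "picker_win F"
  unfolding picker_win_def using assms by (meson cp_picker_wins_subset)

lemma picker_win_mono:
  assumes "picker_win F" "\<And>E. E \<in> G \<Longrightarrow> \<exists>E'\<in>F. E' \<subseteq> E"
  shows "picker_win G"
  using assms cp_picker_wins_mono[of F _ "{}" G "{}"] unfolding picker_win_def by blast

lemma picker_win_empty: "picker_win {}"
proof -
  have "cp_picker_wins {} U C" if "finite U" for U C :: "'a set"
    using that
  proof (induction U arbitrary: C)
    case empty
    then show ?case by (intro cp_picker_wins.finish_empty) auto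
  next
    case (insert v U)
    then show ?case by (simp add: cp_picker_wins_free_chosen)
  qed
  then show ?thesis by (simp add: picker_win_def)
qed

text \<open>One round in terms of edges only: those through Picker's new vertex disappear, and the
  others lose Chooser's new vertex.\<close>

lemma picker_win_offer:
  assumes "x \<noteq> y"
    and "picker_win ((\<lambda>E. E - {x}) ` {E \<in> F. y \<notin> E})"
    and "picker_win ((\<lambda>E. E - {y}) ` {E \<in> F. x \<notin> E})"
  shows "picker_win F"
proof (rule picker_winI)
  fix U :: "'a set"
  assume "finite U"
  \<comment> \<open>The board \<open>U\<close> need not contain \<open>x\<close> and
    \<open>y\<close>; adding them makes the offer legal.\<close>
  define W where "W = U \<union> {x, y}"
  have fin: "finite (W - {x, y})" using \<open>finite U\<close> by (simp add: W_def)
  have "cp_picker_wins F (W - {x, y}) {a}"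
    if "picker_win ((\<lambda>E. E - {a}) ` {E \<in> F. b \<notin> E})" "{a, b} = {x, y}" "a \<noteq> b" for a b
  proof (rule cp_picker_wins_avoid)
    show "cp_picker_wins {E \<in> F. b \<notin> E} (W - {x, y}) {a}"
      using cp_picker_wins_residual[of "{a}" "{E \<in> F. b \<notin> E}" "W - {x, y}" "{}"] that fin
      by (simp add: picker_win_def)
  qed (use that in auto)
  from this[of x y] this[of y x] assms
  have "cp_picker_wins F (W - {x, y}) {x}" "cp_picker_wins F (W - {x, y}) {y}" by auto
  then have "cp_picker_wins F W {}"
    using cp_picker_wins.pick[of x W y F "{}"] assms(1) by (simp add: W_def)
  then show "\<exists>W. finite W \<and> U \<subseteq> W \<and> cp_picker_wins F W {}"
    using \<open>finite U\<close> by (intro exI[of _ W]) (auto simp: W_def)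
qed

text \<open>If the two answers of Chooser need not be distinguished, grant Chooser both vertices
  and only discard the edges that contain both.\<close>

lemma picker_win_pair:
  assumes "x \<noteq> y" "picker_win ((\<lambda>E. E - {x, y}) ` {E \<in> F. \<not> {x, y} \<subseteq> E})"
  shows "picker_win F"
proof (rule picker_win_offer[OF assms(1)])
  show "picker_win ((\<lambda>E. E - {x}) ` {E \<in> F. y \<notin> E})"
    by (rule picker_win_mono[OF assms(2)]) blast
  show "picker_win ((\<lambda>E. E - {y}) ` {E \<in> F. x \<notin> E})"
    by (rule picker_win_mono[OF assms(2)]) blast
qed

lemma picker_win_image:
  fixes f :: "'a \<Rightarrow> 'b"
  assumes "picker_win F" "inj f"
  shows "picker_win ((`) f ` F)"
  unfolding picker_win_def
proof (intro allI impI)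
  fix U :: "'b set" assume "finite U"
  let ?W = "f ` (f -` U)"
  have "finite (f -` U)" using \<open>finite U\<close> assms(2) by (simp add: finite_vimageI)
  then have W: "cp_picker_wins ((`) f ` F) ?W {}"
    using cp_picker_wins_image[of F "f -` U" "{}" f] assms by (simp add: picker_win_def)
  \<comment> \<open>Vertices of \<open>U\<close> outside the range of \<open>f\<close> lie in no
    edge and form a separate game without edges.\<close>
  have "cp_picker_wins {} (U - ?W) {}"
    using picker_win_empty \<open>finite U\<close> unfolding picker_win_def by blast
  from cp_picker_wins_disjoint_Un[OF W this]
  have "cp_picker_wins ((`) f ` F \<union> {}) (?W \<union> (U - ?W)) ({} \<union> {})" by auto
  moreover have "?W \<union> (U - ?W) = U" by auto
  ultimately show "cp_picker_wins ((`) f ` F) U {}" by simp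
qed

lemma picker_win_disjoint_Un:
  assumes "picker_win F" "picker_win G" "\<Union>F \<inter> \<Union>G = {}"
  shows "picker_win (F \<union> G)"
  unfolding picker_win_def
proof (intro allI impI)
  fix U :: "'a set" assume "finite U"
  then have "cp_picker_wins F (U \<inter> \<Union>F) {}" "cp_picker_wins G (U - \<Union>F) {}"
    using assms by (auto simp: picker_win_def)
  then have "cp_picker_wins (F \<union> G) ((U \<inter> \<Union>F) \<union> (U - \<Union>F)) ({} \<union> {})"
    using assms(3) by (intro cp_picker_wins_disjoint_Un) auto
  then show "cp_picker_wins (F \<union> G) U {}" by (simp add: Un_Diff_Int Un_commute Int_Diff_Un)
qed

lemma picker_win_disjoint_UN:
  assumes "finite I" "\<And>i. i \<in> I \<Longrightarrow> picker_win (H i)"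
    and "\<And>i j. i \<in> I \<Longrightarrow> j \<in> I \<Longrightarrow> i \<noteq> j \<Longrightarrow> \<Union>(H i) \<inter> \<Union>(H j) = {}"
  shows "picker_win (\<Union>i\<in>I. H i)"
  using assms
proof (induction I)
  case empty
  then show ?case by (simp add: picker_win_empty)
next
  case (insert i I)
  have "\<Union>(H i) \<inter> \<Union>(\<Union>j\<in>I. H j) = {}"
    using insert.prems(2)[of i] insert.hyps by fastforce
  then have "picker_win (H i \<union> (\<Union>j\<in>I. H j))"
    using insert by (intro picker_win_disjoint_Un) auto
  then show ?case by simp
qed

section \<open>Executable strategies\<close>

text \<open>A strategy is a list of offers.  After \<open>Offer x y ms ns\<close> Picker continues with \<open>ms\<close> or \<open>ns\<close>
  according to whether Chooser takes \<open>x\<close> or \<open>y\<close>, and then with the rest of the list;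
  after \<open>Pair x y\<close> the continuation does not depend on the answer.\<close>

datatype 'a move = Pair 'a 'a | Offer 'a 'a "'a move list" "'a move list"

definition after_offer :: "'a \<Rightarrow> 'a \<Rightarrow> 'a list list \<Rightarrow> 'a list list" where
  "after_offer x y es = map (filter (\<lambda>z. z \<noteq> x)) (filter (\<lambda>e. \<not> List.member e y) es)"

definition after_pair :: "'a \<Rightarrow> 'a \<Rightarrow> 'a list list \<Rightarrow> 'a list list" where
  "after_pair x y es = map (filter (\<lambda>z. z \<noteq> x \<and> z \<noteq> y))
     (filter (\<lambda>e. \<not> (List.member e x \<and> List.member e y)) es)"

text \<open>An illegal offer with \<open>x = y\<close> stops the evaluation and returns the current
  list, which keeps the soundness proof free of a legality condition. \<open>remdups\<close> merges
  equal positions, so the common tail \<open>ms\<close> is evaluated once for each of them.\<close>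

fun outcomes :: "'a move list \<Rightarrow> 'a list list \<Rightarrow> 'a list list list" where
  "outcomes [] es = [es]"
| "outcomes (Pair x y # ms) es = (if x = y then [es] else outcomes ms (after_pair x y es))"
| "outcomes (Offer x y as bs # ms) es = (if x = y then [es] else
     concat (map (outcomes ms)
       (remdups (outcomes as (after_offer x y es) @ outcomes bs (after_offer y x es)))))"

abbreviation edges :: "'a list list \<Rightarrow> 'a set set" where
  "edges es \<equiv> set ` set es"

lemma edges_after_offer: "edges (after_offer x y es) = (\<lambda>E. E - {x}) ` {E \<in> edges es. y \<notin> E}"
  unfolding after_offer_def by (force simp: image_iff)

lemma edges_after_pair:
  "edges (after_pair x y es) = (\<lambda>E. E - {x, y}) ` {E \<in> edges es. \<not> {x, y} \<subseteq> E}"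
  unfolding after_pair_def by (force simp: image_iff)

text \<open>Soundness by backward induction: wins at all final positions propagate back through the
  offers to the initial family.\<close>

lemma picker_win_outcomes:
  assumes "\<And>rs. rs \<in> set (outcomes ms es) \<Longrightarrow> picker_win (edges rs)"
  shows "picker_win (edges es)"
  using assms
proof (induction ms es rule: outcomes.induct)
  case (1 es)
  then show ?case by simp
next
  case (2 x y ms es)
  show ?case
  proof (cases "x = y")
    case False
    then have "picker_win (edges (after_pair x y es))" using 2 by simp
    then show ?thesis unfolding edges_after_pair by (rule picker_win_pair[OF False])
  qed (use 2 in simp)
next
  case (3 x y as bs ms es)
  show ?case
  proof (cases "x = y")
    case False
    \<comment> \<open>The tail \<open>ms\<close> wins from every position in which a branch can end;
      the induction hypotheses for \<open>as\<close> and \<open>bs\<close> carry this back to the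
      positions right after the two answers.\<close>
    have "picker_win (edges rs)"
      if "rs \<in> set (outcomes as (after_offer x y es)) \<union> set (outcomes bs (after_offer y x es))" for rs
      using 3(3)[OF False, of rs] 3(4) False that by auto
    then have "picker_win (edges (after_offer x y es))" "picker_win (edges (after_offer y x es))"
      using 3(1,2) False by blast+
    then show ?thesis unfolding edges_after_offer by (rule picker_win_offer[OF False])
  qed (use 3 in simp)
qed

text \<open>An edge disappears from the list only once Picker owns one of its vertices. A completed
  edge would survive as an empty list inside \<open>rs\<close>, so the test \<open>rs = []\<close>
  does exclude a win of Chooser.\<close>

corollary picker_win_strategy:
  assumes "list_all (\<lambda>rs. rs = []) (outcomes ms es)"
  shows "picker_win (edges es)"
  by (rule picker_win_outcomes) (use assms in \<open>auto simp: list_all_iff picker_win_empty\<close>)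

section \<open>The 8 by 4 rectangle\<close>

text \<open>The cell in column \<open>x\<close> and row \<open>y\<close> has the code \<open>10 * y + x\<close>.\<close>

definition rect_edges :: "int list list" where
  "rect_edges =
    [[0,1,2,3], [4,5,6,7], [10,11,12,13], [14,15,16,17],
     [20,21,22,23], [24,25,26,27], [30,31,32,33], [34,35,36,37],
     [0,10,20,30], [1,11,21,31], [2,12,22,32], [3,13,23,33],
     [4,14,24,34], [5,15,25,35], [6,16,26,36], [7,17,27,37],
     [0,11,22,33], [1,12,23,34], [2,13,24,35], [3,14,25,36], [4,15,26,37],
     [5,16,27], [20,31], [10,21,32],
     [30,21,12,3], [31,22,13,4], [32,23,14,5], [33,24,15,6], [34,25,16,7],
     [35,26,17], [36,27], [20,11,2]]"

text \<open>Whatever Chooser answers to \<open>Offer 20 31\<close>, the next offer is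
  \<open>27 36\<close>: the two edges of size two are destroyed first.\<close>

definition rect_strategy :: "int move list" where
  "rect_strategy =
   [Offer 20 31 [Offer 27 36 [Offer 2 11 [Offer 5 16 [Pair 13 33, Pair 14 34, Offer 23 32 [Pair 21
   22, Offer 1 12 [Pair 0 3, Pair 10 30] [Pair 0 10, Pair 3 30]] [Pair 12 22, Offer 10 21 [Pair 0
   30, Pair 1 3] [Pair 0 1, Pair 3 30]], Offer 24 35 [Pair 25 26, Offer 6 15 [Pair 4 7, Pair 17 37]
   [Pair 4 37, Pair 7 17]] [Pair 15 25, Offer 17 26 [Pair 4 6, Pair 7 37] [Pair 4 37, Pair 6 7]]]
   [Offer 1 3 [Pair 0 30, Pair 6 33, Pair 13 35, Offer 17 26 [Pair 14 15, Pair 4 24, Pair 7 37,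
   Pair 25 34, Offer 12 23 [Pair 10 21, Pair 22 32] [Pair 10 32, Pair 21 22]] [Pair 15 37, Pair 4
   14, Pair 24 25, Pair 7 34, Offer 12 23 [Pair 10 21, Pair 22 32] [Pair 10 32, Pair 21 22]]] [Pair
   22 23, Offer 12 32 [Pair 0 10, Pair 21 30] [Pair 0 30, Pair 10 21], Offer 13 33 [Offer 24 35
   [Pair 25 26, Offer 7 34 [Offer 17 37 [Pair 14 15] [Pair 4 15]] [Offer 4 14 [Pair 15 37] [Pair 15
   17]]] [Pair 25 34, Pair 7 37, Offer 17 26 [Pair 14 15] [Pair 4 15]]] [Offer 7 25 [Pair 6 24,
   Pair 4 34, Offer 17 37 [Pair 14 15, Pair 26 35] [Pair 15 26]] [Offer 24 26 [Pair 4 34, Pair 6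
   15, Pair 14 17] [Pair 4 37, Pair 14 15, Pair 17 35]]]]]] [Pair 1 34, Offer 5 16 [Offer 0 22
   [Offer 14 23 [Offer 4 24 [Pair 6 7, Offer 17 37 [Pair 15 25, Pair 26 35] [Pair 15 26, Pair 25
   35]] [Pair 6 33, Pair 7 37, Offer 25 26 [Pair 15 35] [Pair 17 35]], Pair 12 13, Offer 10 30
   [Pair 21 32] [Pair 3 21]] [Pair 3 33, Offer 10 30 [Pair 12 13, Pair 21 32] [Pair 12 21], Pair 4
   7, Offer 17 37 [Offer 26 35 [Pair 6 15, Pair 24 25] [Pair 6 24, Pair 15 25]] [Offer 15 26 [Pair
   6 24, Pair 25 35] [Pair 24 25]]]] [Offer 4 24 [Pair 6 7, Offer 17 37 [Pair 15 25, Pair 26 35]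
   [Pair 15 26, Pair 25 35], Pair 12 13, Offer 21 23 [Pair 3 30, Pair 10 32] [Pair 14 32, Pair 3
   33]] [Pair 7 37, Pair 6 33, Offer 21 23 [Pair 3 30, Pair 10 32, Pair 12 13] [Pair 3 13, Pair 10
   12, Pair 14 32], Offer 25 26 [Pair 15 35] [Pair 17 35]]]] [Pair 6 33, Offer 0 22 [Pair 3 23,
   Offer 10 30 [Pair 12 13, Pair 21 32] [Pair 12 21]] [Offer 21 23 [Pair 3 30, Pair 10 32, Pair 12
   13] [Pair 3 13, Pair 10 12]], Offer 7 25 [Pair 4 24, Offer 17 37 [Pair 14 15, Pair 26 35] [Pair
   15 26]] [Offer 24 26 [Pair 4 14, Pair 15 17] [Pair 4 37, Pair 14 15, Pair 17 35]]]]] [Offer 3 14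
   [Offer 2 11 [Offer 0 1 [Pair 13 33, Offer 10 30 [Offer 21 32 [Pair 22 23] [Pair 12 22]] [Offer
   12 21 [Pair 22 32] [Pair 22 23]], Offer 24 35 [Pair 25 34, Offer 6 15 [Pair 16 26, Pair 4 5]
   [Pair 4 26]] [Pair 17 26, Pair 6 16, Offer 34 37 [Offer 7 25 [Pair 4 5] [Pair 5 15]] [Offer 4 15
   [Pair 5 7] [Pair 5 25]]]] [Offer 6 16 [Pair 4 7, Pair 5 25, Offer 23 34 [Offer 21 22 [Pair 12
   30, Pair 10 32] [Pair 12 32], Offer 13 33 [Pair 15 37, Pair 17 26, Pair 24 35] [Pair 15 24, Pair
   17 35, Pair 26 37]] [Offer 35 37 [Pair 13 24, Pair 15 33, Pair 17 26] [Pair 15 26, Pair 24 33],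
   Offer 12 21 [Pair 22 32] [Pair 10 32]]] [Pair 7 25, Pair 5 15, Offer 23 34 [Offer 21 22 [Pair 12
   30, Pair 10 32] [Pair 12 32], Pair 4 37, Pair 13 33, Pair 17 26, Pair 24 35] [Pair 13 24, Offer
   35 37 [Pair 17 26] [Pair 4 26], Offer 12 21 [Pair 22 32] [Pair 10 32]]]]] [Offer 6 16 [Pair 15
   24, Pair 1 34, Offer 35 37 [Pair 4 7, Pair 5 25, Pair 17 26] [Pair 4 26, Pair 5 7], Offer 0 33
   [Pair 22 23, Offer 10 30 [Pair 12 13, Pair 21 32] [Pair 12 21]] [Offer 13 23 [Offer 10 12 [Pair
   21 32] [Pair 21 30]] [Pair 10 32, Pair 12 30, Pair 21 22]]] [Pair 7 25, Pair 5 15, Pair 1 34,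
   Offer 35 37 [Pair 17 26] [Pair 4 26], Offer 0 33 [Pair 22 23, Offer 10 30 [Pair 12 13, Pair 21
   32] [Pair 12 21]] [Offer 13 23 [Offer 10 12 [Pair 21 32] [Pair 21 30]] [Pair 10 32, Pair 12 30,
   Pair 21 22]]]]] [Offer 2 11 [Pair 0 30, Pair 13 24, Offer 4 34 [Pair 5 7, Offer 23 32 [Pair 21
   22] [Pair 10 21, Pair 12 22], Offer 15 26 [Pair 16 17, Pair 6 33, Pair 25 35] [Pair 6 16, Pair
   17 35]] [Pair 35 37, Offer 23 32 [Pair 1 12, Pair 21 22, Offer 17 26 [Pair 6 33, Offer 15 16
   [Pair 5 25] [Pair 7 25]] [Offer 6 16 [Pair 5 25, Pair 15 33] [Pair 5 15, Pair 7 25]]] [Pair 10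
   21, Pair 12 22, Offer 17 26 [Pair 6 33, Offer 15 16 [Pair 5 25] [Pair 7 25]] [Offer 6 16 [Pair 5
   25, Pair 15 33] [Pair 5 15, Pair 7 25]]]]] [Pair 4 24, Offer 34 37 [Offer 5 33 [Offer 6 7 [Offer
   16 26 [Pair 15 17, Pair 25 35] [Pair 15 25, Pair 17 35]] [Offer 16 25 [Pair 15 17, Pair 26 35]
   [Pair 15 35, Pair 17 26]], Pair 0 30, Offer 23 32 [Pair 1 12, Pair 10 13, Pair 21 22] [Pair 10
   21, Pair 12 13]] [Pair 7 25, Offer 6 15 [Pair 16 26, Pair 17 35] [Pair 16 17, Pair 26 35], Offer
   0 22 [Pair 1 23, Pair 12 13, Pair 10 30, Pair 21 32] [Offer 21 23 [Pair 10 32, Pair 12 13] [Pair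
   1 12, Pair 10 13]]]] [Pair 12 13, Offer 15 26 [Pair 16 17, Pair 25 35, Offer 6 33 [Pair 0 30,
   Pair 5 7, Offer 23 32 [Pair 21 22] [Pair 10 21]] [Offer 0 22 [Pair 5 23, Pair 10 30, Pair 21 32]
   [Offer 21 23 [Pair 10 32] [Pair 5 32]]]] [Pair 6 16, Pair 5 7, Offer 23 32 [Pair 10 30, Pair 0
   33, Pair 21 22] [Pair 10 21, Pair 0 30, Pair 22 33], Pair 17 35]]]]]] [Offer 27 36 [Offer 4 13
   [Offer 5 16 [Offer 6 7 [Offer 1 11 [Pair 0 3, Pair 2 22, Offer 24 33 [Offer 25 26 [Pair 15 35]
   [Pair 17 35, Pair 15 37], Offer 14 34 [Pair 12 30, Pair 10 21, Pair 23 32] [Pair 10 32, Pair 12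
   23, Pair 21 30]] [Offer 30 32 [Pair 12 21, Pair 23 34] [Pair 10 21, Pair 12 34, Pair 14 23],
   Offer 15 26 [Pair 25 35] [Pair 17 35]]] [Pair 0 22, Pair 2 12, Offer 24 33 [Offer 25 26 [Pair 15
   35] [Pair 17 35, Pair 15 37], Pair 3 30, Pair 10 21, Pair 14 34, Pair 23 32] [Pair 14 23, Offer
   30 32 [Pair 3 21] [Pair 10 21], Offer 15 26 [Pair 25 35] [Pair 17 35]]]] [Pair 14 34, Offer 23
   32 [Pair 22 33, Offer 1 12 [Pair 11 21, Pair 0 2] [Pair 3 21]] [Pair 10 21, Pair 1 11, Offer 30
   33 [Offer 3 12 [Pair 0 2] [Pair 2 22]] [Offer 0 22 [Pair 2 3] [Pair 2 12]]], Offer 17 37 [Offer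
   26 35 [Pair 24 25] [Pair 15 25]] [Offer 15 26 [Pair 25 35] [Pair 24 25]]]] [Offer 1 11 [Pair 12
   23, Pair 6 33, Offer 30 32 [Pair 0 2, Pair 3 21] [Pair 10 21, Pair 0 3, Pair 2 22], Offer 7 34
   [Pair 24 25, Offer 17 37 [Pair 14 15, Pair 26 35] [Pair 15 26]] [Offer 14 24 [Offer 15 17 [Pair
   26 37] [Pair 26 35]] [Pair 15 37, Pair 17 35, Pair 25 26]]] [Pair 0 22, Pair 2 12, Pair 6 33,
   Offer 30 32 [Pair 3 21] [Pair 10 21], Offer 7 34 [Pair 24 25, Offer 17 37 [Pair 14 15, Pair 26
   35] [Pair 15 26]] [Offer 14 24 [Offer 15 17 [Pair 26 37] [Pair 26 35]] [Pair 15 37, Pair 17 35,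
   Pair 25 26]]]]] [Offer 5 16 [Pair 7 37, Pair 14 23, Offer 3 33 [Pair 0 2, Offer 24 35 [Pair 25
   26] [Pair 15 25, Pair 17 26], Offer 12 21 [Pair 10 11, Pair 22 32, Pair 1 34] [Pair 1 11, Pair
   10 32]] [Pair 30 32, Offer 24 35 [Pair 6 15, Offer 10 21 [Pair 1 34, Offer 11 12 [Pair 0 22]
   [Pair 2 22]] [Offer 1 11 [Pair 2 22, Pair 12 34] [Pair 0 22, Pair 2 12]], Pair 25 26] [Offer 10
   21 [Pair 1 34, Offer 11 12 [Pair 0 22] [Pair 2 22]] [Offer 1 11 [Pair 2 22, Pair 12 34] [Pair 0
   22, Pair 2 12]], Pair 15 25, Pair 17 26]]] [Pair 3 23, Offer 30 33 [Pair 14 15, Offer 12 21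
   [Pair 10 11, Pair 22 32, Offer 1 34 [Pair 0 2, Pair 7 37, Offer 24 35 [Pair 25 26] [Pair 17 26]]
   [Offer 7 25 [Pair 2 24, Pair 17 37, Pair 26 35] [Offer 24 26 [Pair 2 35] [Pair 17 35]]]] [Pair 1
   11, Pair 0 2, Offer 24 35 [Pair 17 37, Pair 7 34, Pair 25 26] [Pair 17 26, Pair 7 37, Pair 25
   34], Pair 10 32]] [Offer 2 34 [Offer 0 1 [Offer 11 22 [Pair 10 12, Pair 21 32] [Pair 10 21, Pair
   12 32]] [Offer 11 21 [Pair 10 12, Pair 22 32] [Pair 10 32, Pair 12 22]], Pair 7 37, Offer 24 35
   [Pair 6 15, Pair 14 17, Pair 25 26] [Pair 14 15, Pair 17 26]] [Pair 0 22, Offer 1 12 [Pair 10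
   32, Pair 11 21] [Pair 10 11, Pair 21 32], Offer 7 25 [Pair 6 24, Pair 14 15, Pair 17 37, Pair 26
   35] [Offer 24 26 [Pair 6 15, Pair 14 17] [Pair 14 15, Pair 17 35]]]]]]] [Offer 3 14 [Offer 6 16
   [Offer 13 33 [Pair 5 7, Offer 4 22 [Pair 2 24, Pair 0 1, Pair 23 34, Offer 11 21 [Pair 10 12]
   [Pair 12 30, Pair 10 32], Offer 35 37 [Pair 15 25, Pair 17 26] [Pair 15 26]] [Pair 15 25, Pair
   17 26, Offer 1 2 [Pair 35 37, Pair 23 34, Offer 11 21 [Pair 10 12] [Pair 12 30, Pair 10 32]]
   [Offer 12 32 [Pair 10 11, Pair 21 30] [Pair 10 21], Pair 24 35, Pair 34 37]]] [Pair 15 24, Pair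
   23 34, Offer 30 32 [Pair 12 21, Offer 1 11 [Pair 0 2] [Pair 0 22]] [Pair 10 21, Offer 1 11 [Pair
   0 2, Pair 12 22] [Pair 0 22, Pair 2 12]], Offer 35 37 [Pair 4 7, Pair 5 25, Pair 17 26] [Pair 4
   26, Pair 5 7]]] [Pair 17 26, Pair 24 35, Offer 34 37 [Pair 5 15, Pair 7 25, Offer 23 33 [Offer 1
   12 [Pair 0 2, Pair 10 32, Pair 11 21, Pair 4 13] [Pair 21 30, Offer 10 32 [Pair 4 22, Pair 11
   13] [Pair 2 22, Pair 4 13]]] [Pair 4 13, Offer 30 32 [Offer 12 21 [Pair 1 2, Pair 0 22, Pair 10
   11] [Offer 1 11 [Pair 0 2] [Pair 0 22]]] [Offer 10 21 [Offer 11 12 [Pair 0 22, Pair 1 2] [Pair 0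
   1, Pair 2 22]] [Offer 1 11 [Pair 0 2, Pair 12 22] [Pair 0 22, Pair 2 12]]]]] [Pair 5 25, Pair 4
   15, Offer 13 22 [Pair 0 2, Pair 23 33, Offer 30 32 [Offer 12 21 [Pair 10 11] [Pair 1 11]] [Offer
   10 21 [Pair 11 12] [Pair 1 11]]] [Offer 1 11 [Pair 0 2, Offer 12 32 [Pair 21 30] [Pair 10 21,
   Pair 30 33]] [Pair 0 33, Offer 30 32 [Pair 12 21] [Pair 2 12, Pair 10 21]]]]]] [Pair 0 22, Offer
   4 13 [Offer 24 34 [Pair 1 11, Pair 2 12, Pair 10 21, Offer 15 26 [Pair 16 17, Pair 25 35, Offer
   6 33 [Pair 5 7, Pair 23 32] [Pair 5 23, Pair 30 32]] [Pair 6 16, Pair 5 7, Pair 23 32, Pair 30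
   33, Pair 17 35]] [Pair 30 33, Offer 23 32 [Pair 1 12, Pair 11 21, Offer 35 37 [Offer 17 26
   [Offer 15 16 [Pair 5 25, Pair 6 7] [Pair 5 6, Pair 7 25]] [Offer 6 16 [Pair 5 7, Pair 15 25]
   [Pair 5 15, Pair 7 25]]] [Offer 15 26 [Pair 5 6, Pair 7 25, Pair 16 17] [Offer 6 16 [Pair 5 7]
   [Pair 7 25]]]] [Pair 2 12, Pair 1 11, Pair 10 21, Offer 35 37 [Offer 17 26 [Offer 15 16 [Pair 5
   25, Pair 6 7] [Pair 5 6, Pair 7 25]] [Offer 6 16 [Pair 5 7, Pair 15 25] [Pair 5 15, Pair 7 25]]]
   [Offer 15 26 [Pair 5 6, Pair 7 25, Pair 16 17] [Offer 6 16 [Pair 5 7] [Pair 7 25]]]]]] [Pair 30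
   33, Offer 2 24 [Offer 12 32 [Pair 10 11, Pair 1 21, Pair 23 34, Pair 35 37, Offer 17 26 [Offer
   15 16 [Pair 5 25] [Pair 7 25]] [Pair 5 15, Pair 6 16, Pair 7 25]] [Pair 1 11, Pair 10 21, Pair 5
   23, Pair 34 37, Pair 6 26, Offer 17 35 [Pair 7 25, Pair 15 16] [Pair 7 16, Pair 15 25]]] [Pair
   34 37, Offer 23 32 [Offer 1 12 [Pair 11 21] [Pair 10 11], Offer 6 15 [Offer 16 26 [Pair 7 25]
   [Pair 17 35]] [Offer 16 17 [Pair 5 35, Pair 7 25] [Pair 5 25, Pair 26 35]]] [Offer 6 15 [Offer
   16 26 [Pair 7 25] [Pair 17 35]] [Offer 16 17 [Pair 5 35, Pair 7 25] [Pair 5 25, Pair 26 35]],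
   Offer 10 21 [Pair 11 12] [Pair 1 11]]]]]]]]"

lemma rect_strategy_wins: "list_all (\<lambda>rs. rs = []) (outcomes rect_strategy rect_edges)"
  by code_simp

section \<open>Tiling the plane by copies of the rectangle\<close>

definition cell :: "int \<times> int \<Rightarrow> int \<Rightarrow> int \<times> int" where
  "cell t c = (8 * fst t + c mod 10, 4 * snd t + c div 10)"

definition tile_edges :: "int \<times> int \<Rightarrow> (int \<times> int) set set" where
  "tile_edges t = (`) (cell t) ` edges rect_edges"

text \<open>Quotient and remainder modulo 10 determine any integer. Injectivity thus holds on all of
  \<open>int\<close>, as \<open>picker_win_image\<close> requires, and not only on the 32 codes of
  the rectangle.\<close>

lemma inj_cell: "inj (cell t)"
proof (rule injI)
  fix a b assume "cell t a = cell t b"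
  then have "a mod 10 = b mod 10" "a div 10 = b div 10" by (auto simp: cell_def)
  then show "a = b" by (metis div_mult_mod_eq)
qed

lemma picker_win_tile_edges: "picker_win (tile_edges t)"
  unfolding tile_edges_def
  using picker_win_image[OF picker_win_strategy[OF rect_strategy_wins] inj_cell] .

definition tile_of :: "int \<times> int \<Rightarrow> int \<times> int" where
  "tile_of p = (fst p div 8, snd p div 4)"

text \<open>Any single cell of a tile edge reveals its tile, so the hypergraphs of different tiles
  are vertex-disjoint.\<close>

lemma tile_of_tile_edges:
  assumes "E \<in> tile_edges t" "p \<in> E"
  shows "tile_of p = t"
proof -
  \<comment> \<open>All codes have column 0 to 7 and row 0 to 3, so the offset inside the tile
    vanishes under the divisions in \<open>tile_of\<close>.\<close>
  have "list_all (list_all (\<lambda>c. c mod 10 div 8 = 0 \<and> c div 10 div 4 = 0)) rect_edges"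
    by code_simp
  then show ?thesis
    using assms by (auto simp: tile_edges_def list_all_iff tile_of_def cell_def)
qed

lemma tile_edges_nonempty: "{} \<notin> tile_edges t"
  by (auto simp: tile_edges_def rect_edges_def)

section \<open>Every line contains an edge of a tile\<close>

definition segment :: "nat \<Rightarrow> int \<times> int \<Rightarrow> int \<times> int \<Rightarrow> (int \<times> int) set" where
  "segment n p d = {(fst p + k * fst d, snd p + k * snd d) | k. k \<in> {0..<int n}}"

lemma segment_shift:
  assumes "0 \<le> i" "i + int m \<le> int n"
  shows "segment m (fst p + i * fst d, snd p + i * snd d) d \<subseteq> segment n p d"
proof
  fix q assume "q \<in> segment m (fst p + i * fst d, snd p + i * snd d) d"
  then obtain k where "k \<in> {0..<int m}" and
    "q = (fst p + (i + k) * fst d, snd p + (i + k) * snd d)"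
    by (auto simp: segment_def algebra_simps)
  then show "q \<in> segment n p d"
    using assms unfolding segment_def by (intro CollectI exI[of _ "i + k"]) auto
qed

lemma segment_4:
  "segment 4 p d = {p, (fst p + fst d, snd p + snd d),
     (fst p + 2 * fst d, snd p + 2 * snd d), (fst p + 3 * fst d, snd p + 3 * snd d)}"
proof -
  have "{0..<int 4} = {0, 1, 2, 3}" by auto
  then show ?thesis unfolding segment_def by (auto simp: prod_eq_iff)
qed

definition contains_tile_edge :: "(int \<times> int) set \<Rightarrow> bool" where
  "contains_tile_edge S \<longleftrightarrow> (\<exists>t. \<exists>E\<in>tile_edges t. E \<subseteq> S)"

lemma contains_tile_edge_mono: "contains_tile_edge S \<Longrightarrow> S \<subseteq> S' \<Longrightarrow> contains_tile_edge S'"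
  unfolding contains_tile_edge_def by blast

lemma contains_tile_edgeI:
  assumes "e \<in> set rect_edges" "cell t ` set e \<subseteq> S"
  shows "contains_tile_edge S"
  using assms unfolding contains_tile_edge_def tile_edges_def by blast

section \<open>Aligned segments of four cells in the four directions\<close>

lemma mod_8_cases:
  fixes a :: int
  obtains i where "a = 8 * i" | i where "a = 8 * i + 1" | i where "a = 8 * i + 2"
    | i where "a = 8 * i + 3" | i where "a = 8 * i + 4" | i where "a = 8 * i + 5"
    | i where "a = 8 * i + 6" | i where "a = 8 * i + 7"
proof -
  have "a = 8 * (a div 8) + a mod 8" by simp
  moreover have "a mod 8 \<in> {0, 1, 2, 3, 4, 5, 6, 7}" by auto
  ultimately show thesis using that by fastforce
qed

lemmas tile_simps = rect_edges_def cell_def segment_4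

text \<open>An aligned block is the left or the right half of one of the four rows of a
  tile.\<close>

lemma horizontal_contains_tile_edge:
  assumes "fst q mod 4 = 0"
  shows "contains_tile_edge (segment 4 q (1, 0))"
proof -
  have "\<exists>i. fst q = 8 * i \<or> fst q = 8 * i + 4" using assms by presburger
  then obtain i where "fst q = 8 * i \<or> fst q = 8 * i + 4" by blast
  moreover have "\<exists>j. snd q = 4 * j \<or> snd q = 4 * j + 1 \<or> snd q = 4 * j + 2 \<or> snd q = 4 * j + 3"
    by presburger
  ultimately obtain j where "q \<in> {8 * i, 8 * i + 4} \<times> {4 * j, 4 * j + 1, 4 * j + 2, 4 * j + 3}"
    by (cases q) auto
  then consider
      "q = (8 * i, 4 * j)" | "q = (8 * i, 4 * j + 1)"
    | "q = (8 * i, 4 * j + 2)" | "q = (8 * i, 4 * j + 3)"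
    | "q = (8 * i + 4, 4 * j)" | "q = (8 * i + 4, 4 * j + 1)"
    | "q = (8 * i + 4, 4 * j + 2)" | "q = (8 * i + 4, 4 * j + 3)"
    by auto
  then show ?thesis
  proof cases
    case 1
    then show ?thesis by (intro contains_tile_edgeI[of "[0,1,2,3]" "(i, j)"]) (simp_all add: tile_simps)
  next
    case 2
    then show ?thesis by (intro contains_tile_edgeI[of "[10,11,12,13]" "(i, j)"]) (simp_all add: tile_simps)
  next
    case 3
    then show ?thesis by (intro contains_tile_edgeI[of "[20,21,22,23]" "(i, j)"]) (simp_all add: tile_simps)
  next
    case 4
    then show ?thesis by (intro contains_tile_edgeI[of "[30,31,32,33]" "(i, j)"]) (simp_all add: tile_simps)
  next
    case 5
    then show ?thesis by (intro contains_tile_edgeI[of "[4,5,6,7]" "(i, j)"]) (simp_all add: tile_simps)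
  next
    case 6
    then show ?thesis by (intro contains_tile_edgeI[of "[14,15,16,17]" "(i, j)"]) (simp_all add: tile_simps)
  next
    case 7
    then show ?thesis by (intro contains_tile_edgeI[of "[24,25,26,27]" "(i, j)"]) (simp_all add: tile_simps)
  next
    case 8
    then show ?thesis by (intro contains_tile_edgeI[of "[34,35,36,37]" "(i, j)"]) (simp_all add: tile_simps)
  qed
qed

lemma vertical_contains_tile_edge:
  assumes "snd q mod 4 = 0"
  shows "contains_tile_edge (segment 4 q (0, 1))"
proof -
  define j where "j = snd q div 4"
  have "snd q = 4 * j" using assms unfolding j_def by presburger
  then have q: "q = (fst q, 4 * j)" by (simp add: prod_eq_iff)
  show ?thesis
  proof (cases "fst q" rule: mod_8_cases)
    case (1 i)
    then show ?thesis
      by (subst q, intro contains_tile_edgeI[of "[0,10,20,30]" "(i, j)"]) (simp_all add: tile_simps)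
  next
    case (2 i)
    then show ?thesis
      by (subst q, intro contains_tile_edgeI[of "[1,11,21,31]" "(i, j)"]) (simp_all add: tile_simps)
  next
    case (3 i)
    then show ?thesis
      by (subst q, intro contains_tile_edgeI[of "[2,12,22,32]" "(i, j)"]) (simp_all add: tile_simps)
  next
    case (4 i)
    then show ?thesis
      by (subst q, intro contains_tile_edgeI[of "[3,13,23,33]" "(i, j)"]) (simp_all add: tile_simps)
  next
    case (5 i)
    then show ?thesis
      by (subst q, intro contains_tile_edgeI[of "[4,14,24,34]" "(i, j)"]) (simp_all add: tile_simps)
  next
    case (6 i)
    then show ?thesis
      by (subst q, intro contains_tile_edgeI[of "[5,15,25,35]" "(i, j)"]) (simp_all add: tile_simps)
  next
    case (7 i)
    then show ?thesis
      by (subst q, intro contains_tile_edgeI[of "[6,16,26,36]" "(i, j)"]) (simp_all add: tile_simps)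
  next
    case (8 i)
    then show ?thesis
      by (subst q, intro contains_tile_edgeI[of "[7,17,27,37]" "(i, j)"]) (simp_all add: tile_simps)
  qed
qed

text \<open>A diagonal that starts in the bottom row of a tile in columns 0 to 4 stays in the tile.
  From columns 5 to 7 it crosses into the tile on the right, and only its piece in one of the two
  tiles is used.\<close>

lemma rising_contains_tile_edge:
  assumes "snd q mod 4 = 0"
  shows "contains_tile_edge (segment 4 q (1, 1))"
proof -
  define j where "j = snd q div 4"
  have "snd q = 4 * j" using assms unfolding j_def by presburger
  then have q: "q = (fst q, 4 * j)" by (simp add: prod_eq_iff)
  show ?thesis
  proof (cases "fst q" rule: mod_8_cases)
    case (1 i)
    then show ?thesis
      by (subst q, intro contains_tile_edgeI[of "[0,11,22,33]" "(i, j)"]) (simp_all add: tile_simps)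
  next
    case (2 i)
    then show ?thesis
      by (subst q, intro contains_tile_edgeI[of "[1,12,23,34]" "(i, j)"]) (simp_all add: tile_simps)
  next
    case (3 i)
    then show ?thesis
      by (subst q, intro contains_tile_edgeI[of "[2,13,24,35]" "(i, j)"]) (simp_all add: tile_simps)
  next
    case (4 i)
    then show ?thesis
      by (subst q, intro contains_tile_edgeI[of "[3,14,25,36]" "(i, j)"]) (simp_all add: tile_simps)
  next
    case (5 i)
    then show ?thesis
      by (subst q, intro contains_tile_edgeI[of "[4,15,26,37]" "(i, j)"]) (simp_all add: tile_simps)
  next
    case (6 i)
    then show ?thesis
      by (subst q, intro contains_tile_edgeI[of "[5,16,27]" "(i, j)"]) (simp_all add: tile_simps)
  next
    case (7 i)
    then show ?thesis
      \<comment> \<open>Two cells lie on each side of the border here; the pair in the right-hand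
        tile is the one kept.\<close>
      by (subst q, intro contains_tile_edgeI[of "[20,31]" "(i + 1, j)"]) (simp_all add: tile_simps)
  next
    case (8 i)
    then show ?thesis
      by (subst q, intro contains_tile_edgeI[of "[10,21,32]" "(i + 1, j)"]) (simp_all add: tile_simps)
  qed
qed

text \<open>A falling diagonal crosses the strip from its top row, hence the residue 3. The edges
  used are the mirror images of the rising ones when the columns of the tile are reversed;
  accordingly column 6 now keeps the pair in the left-hand tile.\<close>

lemma falling_contains_tile_edge:
  assumes "snd q mod 4 = 3"
  shows "contains_tile_edge (segment 4 q (1, -1))"
proof -
  define j where "j = snd q div 4"
  have "snd q = 4 * j + 3" using assms unfolding j_def by presburger
  then have q: "q = (fst q, 4 * j + 3)" by (simp add: prod_eq_iff)
  show ?thesis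
  proof (cases "fst q" rule: mod_8_cases)
    case (1 i)
    then show ?thesis
      by (subst q, intro contains_tile_edgeI[of "[30,21,12,3]" "(i, j)"]) (simp_all add: tile_simps)
  next
    case (2 i)
    then show ?thesis
      by (subst q, intro contains_tile_edgeI[of "[31,22,13,4]" "(i, j)"]) (simp_all add: tile_simps)
  next
    case (3 i)
    then show ?thesis
      by (subst q, intro contains_tile_edgeI[of "[32,23,14,5]" "(i, j)"]) (simp_all add: tile_simps)
  next
    case (4 i)
    then show ?thesis
      by (subst q, intro contains_tile_edgeI[of "[33,24,15,6]" "(i, j)"]) (simp_all add: tile_simps)
  next
    case (5 i)
    then show ?thesis
      by (subst q, intro contains_tile_edgeI[of "[34,25,16,7]" "(i, j)"]) (simp_all add: tile_simps)
  next
    case (6 i)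
    then show ?thesis
      by (subst q, intro contains_tile_edgeI[of "[35,26,17]" "(i, j)"]) (simp_all add: tile_simps)
  next
    case (7 i)
    then show ?thesis
      by (subst q, intro contains_tile_edgeI[of "[36,27]" "(i, j)"]) (simp_all add: tile_simps)
  next
    case (8 i)
    then show ?thesis
      by (subst q, intro contains_tile_edgeI[of "[20,11,2]" "(i + 1, j)"]) (simp_all add: tile_simps)
  qed
qed

text \<open>At most three steps lead to an aligned cell, and four more cells complete the segment:
  this is where the length 7 = 3 + 4 comes from.\<close>

lemma seven_contains_tile_edge:
  assumes "d \<in> {(1,0), (0,1), (1,1), (1,-1)}"
  shows "contains_tile_edge (segment 7 p d)"
proof -
  \<comment> \<open>\<open>i\<close> counts the steps to alignment: a column divisible by 4, a row
    divisible by 4, or, for falling lines, where rows decrease, a row congruent to 3.\<close>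
  define i where "i = (if d = (1,0) then (- fst p) mod 4
    else if d = (1,-1) then (snd p + 1) mod 4 else (- snd p) mod 4)"
  define q where "q = (fst p + i * fst d, snd p + i * snd d)"
  have "0 \<le> i" "i \<le> 3" unfolding i_def by auto
  then have sub: "segment 4 q d \<subseteq> segment 7 p d"
    unfolding q_def by (intro segment_shift) auto
  have "contains_tile_edge (segment 4 q d)"
    using assms
  proof (elim insertE emptyE)
    assume d: "d = (1,0)"
    then have "fst q mod 4 = 0" by (simp add: q_def i_def) presburger
    then show ?thesis using d horizontal_contains_tile_edge by simp
  next
    assume d: "d = (0,1)"
    then have "snd q mod 4 = 0" by (simp add: q_def i_def) presburger
    then show ?thesis using d vertical_contains_tile_edge by simp
  next
    assume d: "d = (1,1)"
    then have "snd q mod 4 = 0" by (simp add: q_def i_def) presburger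
    then show ?thesis using d rising_contains_tile_edge by simp
  next
    assume d: "d = (1,-1)"
    then have "snd q mod 4 = 3" by (simp add: q_def i_def) presburger
    then show ?thesis using d falling_contains_tile_edge by simp
  qed
  then show ?thesis using sub by (rule contains_tile_edge_mono)
qed

theorem theorem4p1:
  fixes A :: "(int \<times> int) set"
  assumes "finite A"
  shows "picker_wins_CP A (seven_in_a_row_edges A)"
proof -
  \<comment> \<open>Only the tiles that meet \<open>A\<close> are taken, which keeps the union
    finite. Their edges may stick out of \<open>A\<close>; \<open>picker_win\<close> covers every
    finite board, so \<open>A\<close> may cut tiles arbitrarily.\<close>
  define G where "G = (\<Union>t\<in>tile_of ` A. tile_edges t)"
  have "picker_win G"
    unfolding G_def
  proof (rule picker_win_disjoint_UN)
    show "finite (tile_of ` A)" using assms by simp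
    show "\<Union>(tile_edges s) \<inter> \<Union>(tile_edges t) = {}" if "s \<noteq> t" for s t
      using that tile_of_tile_edges by blast
  qed (rule picker_win_tile_edges)
  moreover have "\<exists>E'\<in>G. E' \<subseteq> E" if "E \<in> seven_in_a_row_edges A" for E
  proof -
    from that obtain p d where "E \<subseteq> A" "d \<in> {(1,0), (0,1), (1,1), (1,-1)}"
      "E = {(fst p + k * fst d, snd p + k * snd d) | k. k \<in> {0..6::int}}"
      unfolding seven_in_a_row_edges_def by blast
    moreover have "{0..6::int} = {0..<int 7}" by auto
    ultimately have "contains_tile_edge E" "E \<subseteq> A"
      using seven_contains_tile_edge[of d p] by (simp_all add: segment_def)
    then obtain t E' where E': "E' \<in> tile_edges t" "E' \<subseteq> E" "E' \<subseteq> A"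
      unfolding contains_tile_edge_def by blast
    \<comment> \<open>A cell of \<open>E'\<close> lies in \<open>A\<close> and shows that the tile
      \<open>t\<close> is among those collected in \<open>G\<close>.\<close>
    then obtain v where "v \<in> E'" using tile_edges_nonempty by (metis all_not_in_conv)
    then have "t \<in> tile_of ` A" using E' tile_of_tile_edges by blast
    then show ?thesis using E' unfolding G_def by blast
  qed
  ultimately have "picker_win (seven_in_a_row_edges A)" by (rule picker_win_mono)
  then show ?thesis using assms by (simp add: picker_wins_CP_def picker_win_def)
qed

end
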